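(* Let $\mathcal E_1=(Z_1,\sigma_1,\kappa_1)$ and $\mathcal E_2=(Z_2,\sigma_2,\kappa_2)$ be weighted dual skeletons. Then $\mathcal E_1$ and $\mathcal E_2$ are isomorphic if and only if the following three conditions hold: (1) they have the same combinatorial type, i.e. the number $k$ of non-trivial pairs (two-element orbits of the involution) and the number $f$ of fixed points coincide; (2) they have the same degree $K$; (3) there is a bijection between the non-trivial orbits of $\sigma_1$ and those of $\sigma_2$ such that, for each corresponding pair of orbits $O_1,O_2$, the inversion classes of the orbit ratios are equal, $[r_{O_1}]=[r_{O_2}]$; equivalently, the multiset of inversion classes $\{[r_1],\dots,[r_k]\}$ is the same for both skeletons.
   Context: A weighted dual skeleton is a triple $\mathcal E=(Z,\sigma,\kappa)$ where $Z$ is a non-empty finite set, $\sigma:Z\to Z$ satisfies $\sigma^2=\mathrm{id}$, and $\kappa:Z\to\mathbb R_{>0}$ satisfies $\kappa(z)\kappa(\sigma(z))=K$ for all $z\in Z$, with $K>0$ constant; $K$ is the degree. A non-trivial orbit (non-trivial pair) is an orbit $\{z,\sigma(z)\}$ with $\sigma(z)\ne z$. A morphism $\phi:\mathcal E_1\to\mathcal E_2$ is a map $\phi:Z_1\to Z_2$ with $\phi(\sigma_1(z))=\sigma_2(\phi(z))$ and $\kappa_1(z)=\kappa_2(\phi(z))$ for all $z\in Z_1$. Two skeletons are isomorphic if there is a bijective morphism between them. The orbit ratio at $z$ is $r_z=(\kappa(\sigma(z))/\kappa(z))^{1/2}$; it satisfies $r_{\sigma(z)}=r_z^{-1}$. For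 a non-trivial orbit $O$ with chosen representative $z_O$, $r_O:=r_{z_O}$; its inversion class $[r_O]=\{r_O,r_O^{-1}\}$ does not depend on the chosen representative. *)

theory Defs
  imports Complex_Main "HOL-Library.Multiset" "HOL-Library.FuncSet"
begin

text \<open>The maps are total functions on the ambient type; only their values on \<open>points\<close> matter.\<close>

record 'a skeleton =
  points :: "'a set"
  invol  :: "'a \<Rightarrow> 'a"
  weight :: "'a \<Rightarrow> real"

definition weighted_dual_skeleton :: "'a skeleton \<Rightarrow> bool" where
  "weighted_dual_skeleton E \<longleftrightarrow>
     finite (points E) \<and> points E \<noteq> {} \<and>
     invol E \<in> points E \<rightarrow> points E \<and>
     (\<forall>z\<in>points E. invol E (invol E z) = z) \<and>
     (\<forall>z\<in>points E. weight E z > 0) \<and>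
     (\<exists>K>0. \<forall>z\<in>points E. weight E z * weight E (invol E z) = K)"

text \<open>Unique because the point set is non-empty; see \<open>degree_eq\<close> below.\<close>

definition degree :: "'a skeleton \<Rightarrow> real" where
  "degree E = (THE K. \<forall>z\<in>points E. weight E z * weight E (invol E z) = K)"

definition skeleton_morphism :: "'a skeleton \<Rightarrow> 'b skeleton \<Rightarrow> ('a \<Rightarrow> 'b) \<Rightarrow> bool" where
  "skeleton_morphism E F \<phi> \<longleftrightarrow>
     \<phi> \<in> points E \<rightarrow> points F \<and>
     (\<forall>z\<in>points E. \<phi> (invol E z) = invol F (\<phi> z)) \<and>
     (\<forall>z\<in>points E. weight E z = weight F (\<phi> z))"

definition skeleton_isomorphic :: "'a skeleton \<Rightarrow> 'b skeleton \<Rightarrow> bool" where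
  "skeleton_isomorphic E F \<longleftrightarrow>
     (\<exists>\<phi>. skeleton_morphism E F \<phi> \<and> bij_betw \<phi> (points E) (points F))"

definition nontrivial_orbits :: "'a skeleton \<Rightarrow> 'a set set" where
  "nontrivial_orbits E = {{z, invol E z} | z. z \<in> points E \<and> invol E z \<noteq> z}"

definition fixed_points :: "'a skeleton \<Rightarrow> 'a set" where
  "fixed_points E = {z \<in> points E. invol E z = z}"

definition combinatorial_type :: "'a skeleton \<Rightarrow> nat \<times> nat" where
  "combinatorial_type E = (card (nontrivial_orbits E), card (fixed_points E))"

definition orbit_ratio :: "'a skeleton \<Rightarrow> 'a \<Rightarrow> real" where
  "orbit_ratio E z = sqrt (weight E (invol E z) / weight E z)"

definition inversion_class :: "real \<Rightarrow> real set" where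
  "inversion_class r = {r, inverse r}"

text \<open>The ratio at a chosen representative. Only its inversion class is used, which is
  independent of the choice by \<open>inversion_class_orbit_ratio_of\<close> below.\<close>

definition orbit_ratio_of :: "'a skeleton \<Rightarrow> 'a set \<Rightarrow> real" where
  "orbit_ratio_of E Orb = orbit_ratio E (SOME z. z \<in> Orb)"

definition inversion_classes :: "'a skeleton \<Rightarrow> real set multiset" where
  "inversion_classes E =
     image_mset (\<lambda>Orb. inversion_class (orbit_ratio_of E Orb)) (mset_set (nontrivial_orbits E))"

lemma degree_eq:
  assumes "weighted_dual_skeleton E" "z \<in> points E"
  shows "weight E z * weight E (invol E z) = degree E"
proof -
  obtain K where K: "\<forall>z\<in>points E. weight E z * weight E (invol E z) = K"
    using assms(1) unfolding weighted_dual_skeleton_def by blast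
  have "degree E = K"
    unfolding degree_def using K assms(2) by (intro the_equality) auto
  then show ?thesis using K assms(2) by simp
qed

lemma finite_nontrivial_orbits:
  assumes "weighted_dual_skeleton E"
  shows "finite (nontrivial_orbits E)"
proof -
  have "nontrivial_orbits E \<subseteq> (\<lambda>z. {z, invol E z}) ` points E"
    unfolding nontrivial_orbits_def by auto
  then show ?thesis
    using assms finite_subset unfolding weighted_dual_skeleton_def by blast
qed

lemma orbit_ratio_invol:
  assumes "weighted_dual_skeleton E" "z \<in> points E"
  shows "orbit_ratio E (invol E z) = inverse (orbit_ratio E z)"
proof -
  have "invol E (invol E z) = z"
    using assms unfolding weighted_dual_skeleton_def by blast
  then show ?thesis
    unfolding orbit_ratio_def by (simp add: real_sqrt_divide)
qed

lemma inversion_class_orbit_ratio_of: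
  assumes "weighted_dual_skeleton E" "Orb \<in> nontrivial_orbits E" "z \<in> Orb"
  shows "inversion_class (orbit_ratio_of E Orb) = inversion_class (orbit_ratio E z)"
proof -
  obtain w where w: "w \<in> points E" "Orb = {w, invol E w}"
    using assms(2) unfolding nontrivial_orbits_def by blast
  have *: "inversion_class (orbit_ratio E y) = inversion_class (orbit_ratio E w)"
    if "y \<in> Orb" for y
    using that w orbit_ratio_invol[OF assms(1) w(1)]
    unfolding inversion_class_def by auto
  have "(SOME z. z \<in> Orb) \<in> Orb"
    using assms(3) by (rule someI)
  then show ?thesis
    unfolding orbit_ratio_of_def using *[OF assms(3)] * by simp
qed

end

theory Submission
  imports Defs "HOL-Library.Disjoint_Sets" "HOL-Combinatorics.Permutations"
begin

text \<open>
  The idea is that the degree and the orbit ratio together determine the weights. The two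
  weights \<open>a\<close>, \<open>b\<close> on the orbit of \<open>z\<close> satisfy \<open>a b = K\<close> and
  \<open>b / a = r\<^sub>z\<^sup>2\<close>, so that \<open>a = \<surd>K / r\<^sub>z\<close>
  (\<open>weight_eq_degree_ratio\<close>); on a fixed point the weight is just \<open>\<surd>K\<close>. Hence, once the
  degree is given, a skeleton is a disjoint union of orbits without further structure, except that
  each two-element orbit carries the pair \<open>{r, r\<inverse>}\<close>. The pair is unordered because
  neither of the two points is distinguished.

  An isomorphism maps orbits to orbits by taking images, and respects all these data. Conversely,
  equality of inversion classes says that some choice of representatives of two orbits has equal
  ratios, hence equal weights if the degrees agree, so that these orbits are isomorphic
  (\<open>nontrivial_orbit_isomorphism\<close>). Such isomorphisms, one for each two-element orbit, and any
  bijection between the fixed points are then glued together. Finally, a class-preserving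
  bijection between orbits is the same thing as equality of the multisets of classes, by the
  general fact \<open>image_mset_set_eq_iff_bij\<close>.
\<close>

section \<open>Functions with equal multisets of values\<close>

text \<open>Both sides say that the two functions have, over each value, fibres of equal size. The
  case of a single set, where the bijection is a permutation, is transported along an arbitrary
  bijection between the two sets.\<close>

lemma image_mset_set_eq_iff_bij:
  assumes "finite A" "finite B"
  shows "image_mset f (mset_set A) = image_mset g (mset_set B) \<longleftrightarrow>
           (\<exists>\<beta>. bij_betw \<beta> A B \<and> (\<forall>x\<in>A. f x = g (\<beta> x)))"
proof
  assume eq: "image_mset f (mset_set A) = image_mset g (mset_set B)"
  have "card A = card B"
    using arg_cong[OF eq, of size] by simp
  then obtain h where h: "bij_betw h A B"
    using finite_same_card_bij assms by blast
  have "mset_set B = image_mset h (mset_set A)"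
    using h by (simp add: bij_betw_def image_mset_mset_set)
  then have "image_mset f (mset_set A) = image_mset (g \<circ> h) (mset_set A)"
    using eq by (simp add: multiset.map_comp)
  then obtain p where p: "p permutes A" "\<forall>x\<in>A. f x = (g \<circ> h) (p x)"
    using image_mset_eq_implies_permutes[OF assms(1)] by blast
  have "bij_betw (h \<circ> p) A B"
    using permutes_imp_bij[OF p(1)] h by (rule bij_betw_trans)
  then show "\<exists>\<beta>. bij_betw \<beta> A B \<and> (\<forall>x\<in>A. f x = g (\<beta> x))"
    using p(2) by (intro exI[of _ "h \<circ> p"]) simp
next
  assume "\<exists>\<beta>. bij_betw \<beta> A B \<and> (\<forall>x\<in>A. f x = g (\<beta> x))"
  then obtain \<beta> where \<beta>: "bij_betw \<beta> A B" "\<forall>x\<in>A. f x = g (\<beta> x)"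
    by blast
  have "image_mset f (mset_set A) = image_mset g (image_mset \<beta> (mset_set A))"
    using \<beta>(2) assms(1) by (auto simp: multiset.map_comp intro!: image_mset_cong)
  also have "image_mset \<beta> (mset_set A) = mset_set B"
    using \<beta>(1) by (simp add: bij_betw_def image_mset_mset_set)
  finally show "image_mset f (mset_set A) = image_mset g (mset_set B)" .
qed

section \<open>Orbits and weights\<close>

lemma invol_in_points:
  assumes "weighted_dual_skeleton E" "z \<in> points E"
  shows "invol E z \<in> points E"
  using assms unfolding weighted_dual_skeleton_def by blast

lemma invol_invol:
  assumes "weighted_dual_skeleton E" "z \<in> points E"
  shows "invol E (invol E z) = z"
  using assms unfolding weighted_dual_skeleton_def by blast

lemma weight_pos:
  assumes "weighted_dual_skeleton E" "z \<in> points E"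
  shows "weight E z > 0"
  using assms unfolding weighted_dual_skeleton_def by blast

text \<open>Any point of a two-element orbit may serve as its representative.\<close>

lemma nontrivial_orbitD:
  assumes E: "weighted_dual_skeleton E"
    and Orb: "Orb \<in> nontrivial_orbits E" and z: "z \<in> Orb"
  shows "z \<in> points E" "invol E z \<noteq> z" "Orb = {z, invol E z}"
proof -
  obtain w where w: "w \<in> points E" "invol E w \<noteq> w" "Orb = {w, invol E w}"
    using Orb unfolding nontrivial_orbits_def by blast
  have "z \<in> points E \<and> invol E z \<noteq> z \<and> Orb = {z, invol E z}"
    using w z invol_in_points[OF E w(1)] invol_invol[OF E w(1)] by auto
  then show "z \<in> points E" "invol E z \<noteq> z" "Orb = {z, invol E z}"
    by blast+
qed

lemma nontrivial_orbit_nonempty: "Orb \<in> nontrivial_orbits E \<Longrightarrow> Orb \<noteq> {}"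
  unfolding nontrivial_orbits_def by blast

lemma nontrivial_orbits_disjoint:
  assumes "weighted_dual_skeleton E" "P \<in> nontrivial_orbits E" "Q \<in> nontrivial_orbits E"
    "z \<in> P" "z \<in> Q"
  shows "P = Q"
  using nontrivial_orbitD(3)[OF assms(1)] assms by metis

lemma Union_nontrivial_orbits:
  assumes "weighted_dual_skeleton E"
  shows "\<Union> (nontrivial_orbits E) = points E - fixed_points E"
proof
  show "\<Union> (nontrivial_orbits E) \<subseteq> points E - fixed_points E"
    using nontrivial_orbitD(1,2)[OF assms] unfolding fixed_points_def by blast
  show "points E - fixed_points E \<subseteq> \<Union> (nontrivial_orbits E)"
    unfolding nontrivial_orbits_def fixed_points_def by blast
qed

text \<open>Multiplying \<open>a b = K\<close> by \<open>a / b = r\<^sub>z\<^sup>-\<^sup>2\<close> gives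
  \<open>a\<^sup>2 = K / r\<^sub>z\<^sup>2\<close>, and \<open>a > 0\<close> selects the root.\<close>

lemma weight_eq_degree_ratio:
  assumes E: "weighted_dual_skeleton E" and z: "z \<in> points E"
  shows "weight E z = sqrt (degree E) / orbit_ratio E z"
proof -
  let ?a = "weight E z" and ?b = "weight E (invol E z)"
  have pos: "?a > 0" "?b > 0"
    using weight_pos[OF E] z invol_in_points[OF E z] by auto
  have "sqrt (degree E) / orbit_ratio E z = sqrt ((?a * ?b) / (?b / ?a))"
    unfolding degree_eq[OF E z, symmetric] orbit_ratio_def by (simp only: real_sqrt_divide)
  also have "(?a * ?b) / (?b / ?a) = ?a\<^sup>2"
    using pos by (simp add: field_simps power2_eq_square)
  finally show ?thesis
    using pos by simp
qed

lemma weight_fixed_point: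
  assumes "weighted_dual_skeleton E" "z \<in> fixed_points E"
  shows "weight E z = sqrt (degree E)"
proof -
  have z: "z \<in> points E" "invol E z = z"
    using assms(2) unfolding fixed_points_def by auto
  have "orbit_ratio E z = 1"
    using weight_pos[OF assms(1) z(1)] z(2) unfolding orbit_ratio_def by simp
  then show ?thesis
    using weight_eq_degree_ratio[OF assms(1) z(1)] by simp
qed

section \<open>Invariants of an isomorphism\<close>

lemma morphism_degree:
  assumes E: "weighted_dual_skeleton E" and F: "weighted_dual_skeleton F"
    and \<phi>: "skeleton_morphism E F \<phi>"
  shows "degree E = degree F"
proof -
  obtain z where z: "z \<in> points E"
    using E unfolding weighted_dual_skeleton_def by blast
  have "degree E = weight E z * weight E (invol E z)"
    using degree_eq[OF E z] by simp
  also have "\<dots> = weight F (\<phi> z) * weight F (invol F (\<phi> z))"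
    using \<phi> z invol_in_points[OF E z] unfolding skeleton_morphism_def by metis
  also have "\<dots> = degree F"
    using degree_eq[OF F] \<phi> z unfolding skeleton_morphism_def by blast
  finally show ?thesis .
qed

lemma morphism_orbit_ratio:
  assumes E: "weighted_dual_skeleton E" and \<phi>: "skeleton_morphism E F \<phi>" and z: "z \<in> points E"
  shows "orbit_ratio F (\<phi> z) = orbit_ratio E z"
  using \<phi> z invol_in_points[OF E z] unfolding skeleton_morphism_def orbit_ratio_def by metis

text \<open>Injectivity makes a point fixed exactly when its image is.\<close>

lemma isomorphism_fixed_iff:
  assumes E: "weighted_dual_skeleton E" and \<phi>: "skeleton_morphism E F \<phi>"
    and bij: "bij_betw \<phi> (points E) (points F)" and z: "z \<in> points E"
  shows "invol F (\<phi> z) = \<phi> z \<longleftrightarrow> invol E z = z"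
proof -
  have "invol F (\<phi> z) = \<phi> (invol E z)"
    using \<phi> z unfolding skeleton_morphism_def by simp
  moreover have "\<phi> (invol E z) = \<phi> z \<longleftrightarrow> invol E z = z"
    using bij_betw_imp_inj_on[OF bij] z invol_in_points[OF E z] by (simp add: inj_on_eq_iff)
  ultimately show ?thesis by simp
qed

lemma isomorphism_fixed_points:
  assumes E: "weighted_dual_skeleton E" and \<phi>: "skeleton_morphism E F \<phi>"
    and bij: "bij_betw \<phi> (points E) (points F)"
  shows "bij_betw \<phi> (fixed_points E) (fixed_points F)"
proof (rule bij_betw_subset[OF bij])
  show "fixed_points E \<subseteq> points E"
    unfolding fixed_points_def by blast
  have "\<phi> ` fixed_points E = {y \<in> \<phi> ` points E. invol F y = y}"
    using isomorphism_fixed_iff[OF E \<phi> bij] unfolding fixed_points_def by auto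
  then show "\<phi> ` fixed_points E = fixed_points F"
    using bij unfolding fixed_points_def bij_betw_def by simp
qed

lemma isomorphism_nontrivial_orbits:
  assumes E: "weighted_dual_skeleton E" and \<phi>: "skeleton_morphism E F \<phi>"
    and bij: "bij_betw \<phi> (points E) (points F)"
  shows "bij_betw ((`) \<phi>) (nontrivial_orbits E) (nontrivial_orbits F)"
proof (rule bij_betw_subset[OF bij_betw_image_Pow[OF bij]])
  show "nontrivial_orbits E \<subseteq> Pow (points E)"
    using nontrivial_orbitD(1)[OF E] by blast
  have img: "\<phi> ` {z, invol E z} = {\<phi> z, invol F (\<phi> z)}" if "z \<in> points E" for z
    using \<phi> that unfolding skeleton_morphism_def by simp
  show "(`) \<phi> ` nontrivial_orbits E = nontrivial_orbits F"
  proof (intro equalityI subsetI)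
    fix P assume "P \<in> (`) \<phi> ` nontrivial_orbits E"
    then obtain z where z: "z \<in> points E" "invol E z \<noteq> z" "P = \<phi> ` {z, invol E z}"
      unfolding nontrivial_orbits_def by blast
    then have "P = {\<phi> z, invol F (\<phi> z)}" "invol F (\<phi> z) \<noteq> \<phi> z" "\<phi> z \<in> points F"
      using img[OF z(1)] isomorphism_fixed_iff[OF E \<phi> bij z(1)] bij_betwE[OF bij] by auto
    then show "P \<in> nontrivial_orbits F"
      unfolding nontrivial_orbits_def by blast
  next
    fix P assume "P \<in> nontrivial_orbits F"
    then obtain w where w: "w \<in> points F" "invol F w \<noteq> w" "P = {w, invol F w}"
      unfolding nontrivial_orbits_def by blast
    obtain z where z: "z \<in> points E" "w = \<phi> z"
      using bij w(1) unfolding bij_betw_def by blast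
    then have "invol E z \<noteq> z" "P = \<phi> ` {z, invol E z}"
      using w img[OF z(1)] isomorphism_fixed_iff[OF E \<phi> bij z(1)] by auto
    then show "P \<in> (`) \<phi> ` nontrivial_orbits E"
      using z(1) unfolding nontrivial_orbits_def by blast
  qed
qed

lemma isomorphism_inversion_class:
  assumes E: "weighted_dual_skeleton E" and F: "weighted_dual_skeleton F"
    and \<phi>: "skeleton_morphism E F \<phi>" and bij: "bij_betw \<phi> (points E) (points F)"
    and Orb: "Orb \<in> nontrivial_orbits E"
  shows "inversion_class (orbit_ratio_of E Orb) = inversion_class (orbit_ratio_of F (\<phi> ` Orb))"
proof -
  obtain z where z: "z \<in> Orb"
    using nontrivial_orbit_nonempty[OF Orb] by blast
  have img: "\<phi> ` Orb \<in> nontrivial_orbits F"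
    using bij_betwE[OF isomorphism_nontrivial_orbits[OF E \<phi> bij]] Orb by blast
  have "inversion_class (orbit_ratio_of E Orb) = inversion_class (orbit_ratio E z)"
    using E Orb z by (rule inversion_class_orbit_ratio_of)
  also have "\<dots> = inversion_class (orbit_ratio F (\<phi> z))"
    using morphism_orbit_ratio[OF E \<phi> nontrivial_orbitD(1)[OF E Orb z]] by simp
  also have "\<dots> = inversion_class (orbit_ratio_of F (\<phi> ` Orb))"
    using inversion_class_orbit_ratio_of[OF F img imageI[OF z]] by simp
  finally show ?thesis .
qed

section \<open>Constructing an isomorphism from the invariants\<close>

text \<open>Representatives \<open>z\<close> and \<open>w\<close> with equal ratios exist, since passing to the other
  point of an orbit inverts the ratio. Then \<open>z\<close> and \<open>w\<close> have equal weights, their partners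
  do too, and matching representatives and partners is an isomorphism of the orbits.\<close>

lemma nontrivial_orbit_isomorphism:
  assumes E: "weighted_dual_skeleton E" and F: "weighted_dual_skeleton F"
    and deg: "degree E = degree F"
    and P: "P \<in> nontrivial_orbits E" and Q: "Q \<in> nontrivial_orbits F"
    and cls: "inversion_class (orbit_ratio_of E P) = inversion_class (orbit_ratio_of F Q)"
  shows "\<exists>\<psi>. bij_betw \<psi> P Q \<and>
           (\<forall>z\<in>P. \<psi> (invol E z) = invol F (\<psi> z) \<and> weight E z = weight F (\<psi> z))"
proof -
  obtain z y where z: "z \<in> P" and y: "y \<in> Q"
    using nontrivial_orbit_nonempty[OF P] nontrivial_orbit_nonempty[OF Q] by blast
  note zD = nontrivial_orbitD[OF E P z] and yD = nontrivial_orbitD[OF F Q y]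
  have "inversion_class (orbit_ratio E z) = inversion_class (orbit_ratio F y)"
    using inversion_class_orbit_ratio_of[OF E P z] inversion_class_orbit_ratio_of[OF F Q y] cls
    by simp
  then have "orbit_ratio E z \<in> {orbit_ratio F y, orbit_ratio F (invol F y)}"
    unfolding orbit_ratio_invol[OF F yD(1)] inversion_class_def by blast
  then obtain w where w: "w \<in> Q" and ratio: "orbit_ratio E z = orbit_ratio F w"
    using yD(3) by blast
  note wD = nontrivial_orbitD[OF F Q w]
  have wt: "weight E z = weight F w"
    using weight_eq_degree_ratio[OF E zD(1)] weight_eq_degree_ratio[OF F wD(1)] ratio deg by simp
  have "weight E z * weight E (invol E z) = weight F w * weight F (invol F w)"
    using degree_eq[OF E zD(1)] degree_eq[OF F wD(1)] deg by simp
  then have wt': "weight E (invol E z) = weight F (invol F w)"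
    using wt weight_pos[OF E zD(1)] by simp
  define \<psi> where "\<psi> x = (if x = z then w else invol F w)" for x
  have val: "\<psi> z = w" "\<psi> (invol E z) = invol F w"
    using zD(2) by (auto simp: \<psi>_def)
  have "bij_betw \<psi> P Q"
    using val zD(2) wD(2) unfolding zD(3) wD(3) bij_betw_def by auto
  moreover have "\<psi> (invol E x) = invol F (\<psi> x) \<and> weight E x = weight F (\<psi> x)" if "x \<in> P" for x
    using that val wt wt' invol_invol[OF E zD(1)] invol_invol[OF F wD(1)] unfolding zD(3) by auto
  ultimately show ?thesis by blast
qed

text \<open>Orbits partition the points and every orbit is stable under the involution, so a
  bijection and a morphism can both be defined orbit by orbit.\<close>

lemma skeleton_isomorphic_by_orbits:
  assumes E: "weighted_dual_skeleton E" and F: "weighted_dual_skeleton F"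
    and deg: "degree E = degree F"
    and fixed: "card (fixed_points E) = card (fixed_points F)"
    and \<beta>: "bij_betw \<beta> (nontrivial_orbits E) (nontrivial_orbits F)"
    and cls: "\<And>P. P \<in> nontrivial_orbits E \<Longrightarrow>
      inversion_class (orbit_ratio_of E P) = inversion_class (orbit_ratio_of F (\<beta> P))"
  shows "skeleton_isomorphic E F"
proof -
  let ?N = "nontrivial_orbits E"
  have "finite (fixed_points E)" "finite (fixed_points F)"
    using E F unfolding weighted_dual_skeleton_def fixed_points_def by simp_all
  then obtain g where g: "bij_betw g (fixed_points E) (fixed_points F)"
    using finite_same_card_bij fixed by blast
  have "\<forall>P\<in>?N. \<exists>\<psi>. bij_betw \<psi> P (\<beta> P) \<and>
          (\<forall>z\<in>P. \<psi> (invol E z) = invol F (\<psi> z) \<and> weight E z = weight F (\<psi> z))"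
    using nontrivial_orbit_isomorphism[OF E F deg] bij_betwE[OF \<beta>] cls by blast
  then obtain \<psi> where bij: "\<And>P. P \<in> ?N \<Longrightarrow> bij_betw (\<psi> P) P (\<beta> P)"
    and hom: "\<And>P z. P \<in> ?N \<Longrightarrow> z \<in> P \<Longrightarrow>
          \<psi> P (invol E z) = invol F (\<psi> P z) \<and> weight E z = weight F (\<psi> P z)"
    unfolding bchoice_iff by blast
  define \<phi> where
    "\<phi> z = (if z \<in> fixed_points E then g z else \<psi> {z, invol E z} z)" for z
  have \<phi>_fixed: "\<phi> z = g z" if "z \<in> fixed_points E" for z
    using that by (simp add: \<phi>_def)
  have \<phi>_orbit: "\<phi> z = \<psi> P z" if "P \<in> ?N" "z \<in> P" for P z
    using nontrivial_orbitD[OF E that] by (auto simp: \<phi>_def fixed_points_def)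
  have split: "points E = fixed_points E \<union> (\<Union>P\<in>?N. P)"
    "points F = fixed_points F \<union> (\<Union>P\<in>?N. \<beta> P)"
    using Union_nontrivial_orbits[OF E] Union_nontrivial_orbits[OF F] bij_betw_imp_surj_on[OF \<beta>]
    unfolding fixed_points_def by auto
  have bij_\<phi>: "bij_betw \<phi> (points E) (points F)"
    unfolding split
  proof (intro bij_betw_combine bij_betw_UNION_disjoint)
    show "bij_betw \<phi> (fixed_points E) (fixed_points F)"
      using g \<phi>_fixed by (simp cong: bij_betw_cong)
    show "bij_betw \<phi> P (\<beta> P)" if "P \<in> ?N" for P
      using bij[OF that] \<phi>_orbit[OF that] by (simp cong: bij_betw_cong)
    show "disjoint_family_on \<beta> ?N"
      unfolding disjoint_family_on_def
      using nontrivial_orbits_disjoint[OF F] bij_betwE[OF \<beta>] bij_betw_imp_inj_on[OF \<beta>]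
      by (metis disjoint_iff inj_on_eq_iff)
    show "fixed_points F \<inter> (\<Union>P\<in>?N. \<beta> P) = {}"
      using Union_nontrivial_orbits[OF F] bij_betw_imp_surj_on[OF \<beta>] by auto
  qed
  have "\<phi> (invol E z) = invol F (\<phi> z) \<and> weight E z = weight F (\<phi> z)" if z: "z \<in> points E" for z
  proof (cases "z \<in> fixed_points E")
    case True
    then have "g z \<in> fixed_points F"
      using bij_betwE[OF g] by blast
    then show ?thesis
      using True \<phi>_fixed[OF True] weight_fixed_point[OF E True] weight_fixed_point[OF F] deg
      by (simp add: fixed_points_def)
  next
    case False
    then obtain P where P: "P \<in> ?N" "z \<in> P"
      using z split(1) by blast
    then have "invol E z \<in> P"
      using nontrivial_orbitD(3)[OF E P] by blast
    then show ?thesis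
      using \<phi>_orbit P hom by simp
  qed
  then have "skeleton_morphism E F \<phi>"
    using bij_betwE[OF bij_\<phi>] unfolding skeleton_morphism_def by blast
  then show ?thesis
    using bij_\<phi> unfolding skeleton_isomorphic_def by blast
qed

section \<open>The classification\<close>

theorem theorem7p2:
  fixes E1 :: "'a skeleton" and E2 :: "'b skeleton"
  assumes "weighted_dual_skeleton E1" and "weighted_dual_skeleton E2"
  shows "(skeleton_isomorphic E1 E2 \<longleftrightarrow>
            combinatorial_type E1 = combinatorial_type E2 \<and>
            degree E1 = degree E2 \<and>
            (\<exists>\<beta>. bij_betw \<beta> (nontrivial_orbits E1) (nontrivial_orbits E2) \<and>
                 (\<forall>Orb\<in>nontrivial_orbits E1.
                    inversion_class (orbit_ratio_of E1 Orb)
                      = inversion_class (orbit_ratio_of E2 (\<beta> Orb)))))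
       \<and> ((\<exists>\<beta>. bij_betw \<beta> (nontrivial_orbits E1) (nontrivial_orbits E2) \<and>
                 (\<forall>Orb\<in>nontrivial_orbits E1.
                    inversion_class (orbit_ratio_of E1 Orb)
                      = inversion_class (orbit_ratio_of E2 (\<beta> Orb))))
            \<longleftrightarrow> inversion_classes E1 = inversion_classes E2)"
proof (intro conjI iffI)
  let ?matching = "\<lambda>\<beta>. bij_betw \<beta> (nontrivial_orbits E1) (nontrivial_orbits E2) \<and>
                 (\<forall>Orb\<in>nontrivial_orbits E1.
                    inversion_class (orbit_ratio_of E1 Orb)
                      = inversion_class (orbit_ratio_of E2 (\<beta> Orb)))"
  note E = assms
  {
    assume "skeleton_isomorphic E1 E2"
    then obtain \<phi> where \<phi>: "skeleton_morphism E1 E2 \<phi>"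
      and bij: "bij_betw \<phi> (points E1) (points E2)"
      unfolding skeleton_isomorphic_def by blast
    note orbits = isomorphism_nontrivial_orbits[OF E(1) \<phi> bij]
    show "combinatorial_type E1 = combinatorial_type E2"
      unfolding combinatorial_type_def
      using bij_betw_same_card[OF orbits]
        bij_betw_same_card[OF isomorphism_fixed_points[OF E(1) \<phi> bij]] by simp
    show "degree E1 = degree E2"
      using E \<phi> by (rule morphism_degree)
    show "\<exists>\<beta>. ?matching \<beta>"
      using orbits isomorphism_inversion_class[OF E \<phi> bij] by blast
  next
    assume inv: "combinatorial_type E1 = combinatorial_type E2 \<and> degree E1 = degree E2 \<and>
      (\<exists>\<beta>. ?matching \<beta>)"
    then obtain \<beta> where "?matching \<beta>"
      by blast
    then show "skeleton_isomorphic E1 E2"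
      using inv by (intro skeleton_isomorphic_by_orbits[OF E, of \<beta>])
        (auto simp: combinatorial_type_def)
  }
  have multiset: "inversion_classes E1 = inversion_classes E2 \<longleftrightarrow> (\<exists>\<beta>. ?matching \<beta>)"
    unfolding inversion_classes_def
    by (rule image_mset_set_eq_iff_bij) (intro finite_nontrivial_orbits E)+
  show "inversion_classes E1 = inversion_classes E2" if "\<exists>\<beta>. ?matching \<beta>"
    using multiset that by (rule iffD2)
  show "\<exists>\<beta>. ?matching \<beta>" if "inversion_classes E1 = inversion_classes E2"
    using multiset that by (rule iffD1)
qed

end
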